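(* Let $B$ be a bouquet of $n$ circles and let $\ell:H\to B$ be a surjective immersion, where $H$ is a finite connected compressed core graph of rank $m>1$. Let $A_1,\dots,A_k$ be the arcs of $H$. Then there exists a transversal $\mathcal T=\{e_1,\dots,e_k\}$, where each $e_i\in H^1$ is an edge contained in $A_i$, such that $|\ell(\mathcal T)|\ge m$.
   Context: Graphs: a graph $\Gamma$ is a $1$-dimensional CW-complex with vertex set $\Gamma^0$ and edge set $\Gamma^1$ (open $1$-cells), each edge oriented from an origin to a terminus. A morphism sends vertices to vertices and edges homeomorphically to edges (compatibly with origin and terminus); an immersion is a locally injective morphism. A bouquet of $n$ circles is a graph with one vertex and $n$ edges. An immersed graph is a finite graph with a fixed immersion to $B$ (a labelling), and morphisms between immersed graphs are label preserving, i.e. commute with the maps to $B$. The degree of a vertex counts loops twice. A finite graph is a core graph if all vertices have degree $\ge2$. $H^*$ is the set of vertices of degree $\ge3$; an arc of $H$ is a connected component of $H-H^*$. Each edge of $H$ lies in exactly one arc. A finite connected graph has $\mathrm{rank}(\Gamma)=1-|\Gamma^0|+|\Gamma^1|$. Compressed: a connected immersed graph $H\to B$ is compressed if for every connected immersed graph $K\to B$ such that there is a (label preserving) immersion $H\to K$, one has $\mathrm{rank}(H)\le\mathrm{rank}(K)$. *)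

theory Defs
  imports "Graph_Theory.Digraph_Component"
begin

text \<open>
  A graph (a 1-dimensional CW-complex with oriented edges) is given by its combinatorial data: a
  directed multigraph, loops and parallel edges allowed. \<open>verts\<close> is the set of vertices, \<open>arcs\<close> the
  set of edges, \<open>tail\<close> the origin and \<open>head\<close> the terminus. Beware that \<open>arcs\<close> are single edges; the
  arcs of a core graph in the topological sense are \<open>topological_arcs\<close> below.
\<close>

definition graph_morphism ::
  "('v, 'e) pre_digraph \<Rightarrow> ('w, 'f) pre_digraph \<Rightarrow> ('v \<Rightarrow> 'w) \<Rightarrow> ('e \<Rightarrow> 'f) \<Rightarrow> bool" where
  "graph_morphism G K fv fe \<longleftrightarrow>
     (\<forall>v \<in> verts G. fv v \<in> verts K) \<and>
     (\<forall>e \<in> arcs G. fe e \<in> arcs K \<and> tail K (fe e) = fv (tail G e) \<and> head K (fe e) = fv (head G e))"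

text \<open>
  The germs of edges at \<open>v\<close>: an edge contributes an initial germ at its origin and a terminal germ at
  its terminus, so a loop contributes two. A morphism is injective near \<open>v\<close> iff it is injective on
  these germs, and it sends initial germs to initial ones and terminal germs to terminal ones.
\<close>

definition germs :: "('v, 'e) pre_digraph \<Rightarrow> 'v \<Rightarrow> ('e + 'e) set" where
  "germs G v = out_arcs G v <+> in_arcs G v"

definition graph_immersion ::
  "('v, 'e) pre_digraph \<Rightarrow> ('w, 'f) pre_digraph \<Rightarrow> ('v \<Rightarrow> 'w) \<Rightarrow> ('e \<Rightarrow> 'f) \<Rightarrow> bool" where
  "graph_immersion G K fv fe \<longleftrightarrow>
     graph_morphism G K fv fe \<and> (\<forall>v \<in> verts G. inj_on (map_sum fe fe) (germs G v))"

definition graph_surjective ::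
  "('v, 'e) pre_digraph \<Rightarrow> ('w, 'f) pre_digraph \<Rightarrow> ('v \<Rightarrow> 'w) \<Rightarrow> ('e \<Rightarrow> 'f) \<Rightarrow> bool" where
  "graph_surjective G K fv fe \<longleftrightarrow> fv ` verts G = verts K \<and> fe ` arcs G = arcs K"

definition bouquet :: "nat \<Rightarrow> ('b, 'l) pre_digraph \<Rightarrow> bool" where
  "bouquet n B \<longleftrightarrow> fin_digraph B \<and> card (verts B) = 1 \<and> card (arcs B) = n"

definition immersed_graph ::
  "('b, 'l) pre_digraph \<Rightarrow> ('v, 'e) pre_digraph \<Rightarrow> ('v \<Rightarrow> 'b) \<Rightarrow> ('e \<Rightarrow> 'l) \<Rightarrow> bool" where
  "immersed_graph B G lv le \<longleftrightarrow> fin_digraph G \<and> graph_immersion G B lv le"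

definition label_preserving ::
  "('v, 'e) pre_digraph \<Rightarrow> ('v \<Rightarrow> 'b) \<Rightarrow> ('e \<Rightarrow> 'l) \<Rightarrow> ('w \<Rightarrow> 'b) \<Rightarrow> ('f \<Rightarrow> 'l)
     \<Rightarrow> ('v \<Rightarrow> 'w) \<Rightarrow> ('e \<Rightarrow> 'f) \<Rightarrow> bool" where
  "label_preserving G lv le kv ke fv fe \<longleftrightarrow>
     (\<forall>v \<in> verts G. kv (fv v) = lv v) \<and> (\<forall>e \<in> arcs G. ke (fe e) = le e)"

definition vert_degree :: "('v, 'e) pre_digraph \<Rightarrow> 'v \<Rightarrow> nat" where
  "vert_degree G v = in_degree G v + out_degree G v"

definition core_graph :: "('v, 'e) pre_digraph \<Rightarrow> bool" where
  "core_graph G \<longleftrightarrow> fin_digraph G \<and> (\<forall>v \<in> verts G. vert_degree G v \<ge> 2)"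

definition graph_rank :: "('v, 'e) pre_digraph \<Rightarrow> int" where
  "graph_rank G = 1 - int (card (verts G)) + int (card (arcs G))"

text \<open>
  A definition cannot quantify over the type of vertices of \<open>K\<close>. Natural numbers as vertices and
  edges lose nothing: \<open>K\<close> is finite, hence isomorphic to such a graph.
\<close>

definition compressed ::
  "('b, 'l) pre_digraph \<Rightarrow> ('v, 'e) pre_digraph \<Rightarrow> ('v \<Rightarrow> 'b) \<Rightarrow> ('e \<Rightarrow> 'l) \<Rightarrow> bool" where
  "compressed B H lv le \<longleftrightarrow>
     immersed_graph B H lv le \<and> connected H \<and>
     (\<forall>(K :: (nat, nat) pre_digraph) kv ke.
        immersed_graph B K kv ke \<and> connected K \<and>
        (\<exists>fv fe. graph_immersion H K fv fe \<and> label_preserving H lv le kv ke fv fe)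
        \<longrightarrow> graph_rank H \<le> graph_rank K)"

definition branch_verts :: "('v, 'e) pre_digraph \<Rightarrow> 'v set" where
  "branch_verts G = {v \<in> verts G. vert_degree G v \<ge> 3}"

text \<open>
  The space \<open>G\<close> minus \<open>branch_verts G\<close> is the disjoint union of the remaining vertices (\<open>Inl v\<close>) and
  all open edges (\<open>Inr e\<close>). These cells are connected, and the closure of an open edge in this space
  adds exactly those of its end points that have not been removed. So the connected components are
  the unions of the classes of cells under the equivalence relation generated by incidence; a
  component is represented by its set of cells.
\<close>

definition punctured_cells :: "('v, 'e) pre_digraph \<Rightarrow> ('v + 'e) set" where
  "punctured_cells G = (verts G - branch_verts G) <+> arcs G"

definition cell_incidence :: "('v, 'e) pre_digraph \<Rightarrow> (('v + 'e) \<times> ('v + 'e)) set" where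
  "cell_incidence G =
     {(Inl v, Inr e) |v e. v \<in> verts G - branch_verts G \<and> e \<in> arcs G \<and> (v = tail G e \<or> v = head G e)}"

definition topological_arcs :: "('v, 'e) pre_digraph \<Rightarrow> ('v + 'e) set set" where
  "topological_arcs G = punctured_cells G // (cell_incidence G \<union> (cell_incidence G)\<inverse>)\<^sup>*"

end

theory Submission
  imports Defs
begin

text \<open>
  A transversal meeting \<open>m\<close> labels amounts to a matching of size \<open>m\<close> in the bipartite incidence
  relation between topological arcs and labels. By Koenig's theorem, if there is none, then some set
  \<open>Y\<close> of arcs and some set \<open>S\<close> of labels satisfy \<open>|Y| + |S| < m\<close>, and every arc outside \<open>Y\<close> has
  all its labels in \<open>S\<close>. Collapse the part of \<open>H\<close> outside \<open>Y\<close> to a single vertex carrying one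
  loop for each label that occurs there: the resulting graph has rank at most \<open>|Y| + |S|\<close>. Stallings
  foldings do not increase the rank and turn it into an immersed graph \<open>K\<close>. As \<open>H \<rightarrow> B\<close>
  is an immersion and factors through \<open>K\<close>, so is \<open>H \<rightarrow> K\<close>, contradicting that
  \<open>H\<close> is compressed.
\<close>

section \<open>Koenig's theorem\<close>

text \<open>
  Uncrossing: covers \<open>(C, S)\<close> and \<open>(D, T)\<close> of \<open>R\<close> without \<open>p\<close> and without \<open>q\<close> yield the covers
  \<open>(C \<inter> D, S \<union> T)\<close> and \<open>(C \<union> D \<union> {x}, S \<inter> T)\<close> of \<open>R\<close>, where \<open>x\<close> is the
  common end of \<open>p\<close> and \<open>q\<close>; their total size is less than \<open>2 * m\<close>.
\<close>
lemma critical_cover_inj_on_fst: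
  fixes m :: nat
  assumes cover: "\<And>C S. finite C \<Longrightarrow> finite S \<Longrightarrow> \<forall>(x, y)\<in>R. x \<in> C \<or> y \<in> S \<Longrightarrow> m \<le> card C + card S"
    and critical: "\<And>p. p \<in> R \<Longrightarrow>
      \<exists>C S. finite C \<and> finite S \<and> (\<forall>(x, y)\<in>R - {p}. x \<in> C \<or> y \<in> S) \<and> card C + card S < m"
  shows "inj_on fst R"
proof (rule inj_onI, rule ccontr)
  fix p q assume pq: "p \<in> R" "q \<in> R" "fst p = fst q" "p \<noteq> q"
  then obtain x a b where p: "p = (x, a)" and q: "q = (x, b)"
    by (metis prod.collapse)
  obtain C S where C: "finite C" "finite S" "card C + card S < m"
      and cC: "\<forall>(x, y)\<in>R - {p}. x \<in> C \<or> y \<in> S"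
    using critical[OF pq(1)] by blast
  obtain D T where D: "finite D" "finite T" "card D + card T < m"
      and cD: "\<forall>(x, y)\<in>R - {q}. x \<in> D \<or> y \<in> T"
    using critical[OF pq(2)] by blast
  \<comment> \<open>Otherwise \<open>(C, S)\<close> would cover \<open>p\<close> too, hence all of
    \<open>R\<close>, with fewer than \<open>m\<close> elements.\<close>
  have "x \<notin> C"
  proof
    assume "x \<in> C"
    then have "\<forall>(x, y)\<in>R. x \<in> C \<or> y \<in> S" using cC p by auto
    then show False using cover[OF C(1,2)] C(3) by auto
  qed
  have "x \<notin> D"
  proof
    assume "x \<in> D"
    then have "\<forall>(x, y)\<in>R. x \<in> D \<or> y \<in> T" using cD q by auto
    then show False using cover[OF D(1,2)] D(3) by auto
  qed
  have "b \<in> S" using cC pq q \<open>x \<notin> C\<close> by fastforce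
  have "a \<in> T" using cD pq p \<open>x \<notin> D\<close> by fastforce
  have "\<forall>(x, y)\<in>R. x \<in> C \<inter> D \<or> y \<in> S \<union> T"
    using cC cD p q \<open>b \<in> S\<close> \<open>a \<in> T\<close> by auto
  then have 1: "m \<le> card (C \<inter> D) + card (S \<union> T)"
    using cover[of "C \<inter> D" "S \<union> T"] C D by blast
  have "\<forall>(u, y)\<in>R. u \<in> insert x (C \<union> D) \<or> y \<in> S \<inter> T"
    using cC cD p q by auto
  then have 2: "m \<le> card (insert x (C \<union> D)) + card (S \<inter> T)"
    using cover[of "insert x (C \<union> D)" "S \<inter> T"] C D by blast
  \<comment> \<open>Adding \<open>x\<close> costs at most one, while the two given covers have total
    size at most \<open>2 * m - 2\<close>.\<close>
  have "card (insert x (C \<union> D)) \<le> Suc (card (C \<union> D))"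
    by (rule card_insert_le_m1) auto
  then show False
    using 1 2 C(3) D(3) card_Un_Int[OF C(1) D(1)] card_Un_Int[OF C(2) D(2)] by linarith
qed

text \<open>Pairs are deleted as long as every cover of the rest still has size at least
  \<open>m\<close>. Once no pair can be deleted, the relation is itself a matching, by uncrossing
  covers on either side.\<close>

theorem Koenig_matching:
  fixes m :: nat
  assumes "finite R"
    and "\<And>C S. finite C \<Longrightarrow> finite S \<Longrightarrow> \<forall>(x, y)\<in>R. x \<in> C \<or> y \<in> S \<Longrightarrow> m \<le> card C + card S"
  shows "\<exists>M\<subseteq>R. inj_on fst M \<and> inj_on snd M \<and> m \<le> card M"
  using assms
proof (induction R rule: finite_psubset_induct)
  case (psubset R)
  note cover = psubset.prems
  show ?case
  proof (cases "\<exists>p\<in>R. \<forall>C S. finite C \<longrightarrow> finite S \<longrightarrow> (\<forall>(x, y)\<in>R - {p}. x \<in> C \<or> y \<in> S)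
      \<longrightarrow> m \<le> card C + card S")
    case True
    then obtain p where p: "p \<in> R" and "\<And>C S. finite C \<Longrightarrow> finite S \<Longrightarrow>
        \<forall>(x, y)\<in>R - {p}. x \<in> C \<or> y \<in> S \<Longrightarrow> m \<le> card C + card S"
      by blast
    then obtain M where "M \<subseteq> R - {p}" "inj_on fst M" "inj_on snd M" "m \<le> card M"
      using psubset.IH[of "R - {p}"] by blast
    then show ?thesis by blast
  next
    case False
    then have critical: "\<exists>C S. finite C \<and> finite S \<and> (\<forall>(x, y)\<in>R - {p}. x \<in> C \<or> y \<in> S)
        \<and> card C + card S < m" if "p \<in> R" for p
      using that by (meson not_le)
    have inj: "inj_on fst R"
      by (rule critical_cover_inj_on_fst[OF cover critical])
    \<comment> \<open>Passing to the converse swaps the two halves of a cover, so the same lemma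
      yields injectivity of \<open>snd\<close>.\<close>
    have inj_converse: "inj_on fst (R\<inverse>)"
    proof (rule critical_cover_inj_on_fst[where m = m])
      fix C S assume "finite C" "finite S" "\<forall>(x, y)\<in>R\<inverse>. x \<in> C \<or> y \<in> S"
      then show "m \<le> card C + card S" using cover[of S C] by fastforce
    next
      fix p assume "p \<in> R\<inverse>"
      then obtain x y where xy: "p = (y, x)" "(x, y) \<in> R" by auto
      obtain C S where "finite C" "finite S" "card C + card S < m"
          "\<forall>(u, v)\<in>R - {(x, y)}. u \<in> C \<or> v \<in> S"
        using critical[OF xy(2)] by blast
      then show "\<exists>C S. finite C \<and> finite S \<and> (\<forall>(x, y)\<in>R\<inverse> - {p}. x \<in> C \<or> y \<in> S)
          \<and> card C + card S < m"
        using xy by (intro exI[of _ S] exI[of _ C]) auto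
    qed
    have "inj_on snd R"
    proof (rule inj_onI)
      fix p q assume "p \<in> R" "q \<in> R" "snd p = snd q"
      then show "p = q"
        using inj_onD[OF inj_converse, of "prod.swap p" "prod.swap q"] by (cases p; cases q) auto
    qed
    moreover have "m \<le> card R"
      using cover[of "fst ` R" "{}"] \<open>finite R\<close> card_image[OF inj] by force
    ultimately show ?thesis using inj by blast
  qed
qed

section \<open>Components of a finite relation\<close>

text \<open>Without pairs every point is its own class, and each added pair merges at most two
  classes.\<close>

lemma card_le_card_quotient_add_card:
  assumes "finite r" "finite X"
  shows "card X \<le> card (X // (r \<union> r\<inverse>)\<^sup>*) + card r"
  using assms(1)
proof (induction r)
  case empty
  have "X // ({} \<union> {}\<inverse>)\<^sup>* = (\<lambda>x. {x}) ` X"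
    by (auto simp: quotient_def)
  then show ?case by (simp add: card_image)
next
  case (insert p r)
  obtain a b where p: "p = (a, b)" by force
  define R where "R = (r \<union> r\<inverse>)\<^sup>*"
  define R' where "R' = (insert p r \<union> (insert p r)\<inverse>)\<^sup>*"
  have eqR: "equiv UNIV R" unfolding R_def
    by (intro equivI refl_rtrancl sym_rtrancl trans_rtrancl) (auto intro: symI)
  have symR: "(x, y) \<in> R \<Longrightarrow> (y, x) \<in> R" and transR: "(x, y) \<in> R \<Longrightarrow> (y, z) \<in> R \<Longrightarrow> (x, z) \<in> R"
    for x y z
    using eqR by (auto elim!: equivE dest: symD transD)
  have reflR: "(x, x) \<in> R" for x by (simp add: R_def)
  \<comment> \<open>If \<open>x\<close> and \<open>y\<close> are not already related by
    \<open>R\<close>, every chain between them uses the new pair, so each of them is related to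
    \<open>a\<close> or \<open>b\<close> by \<open>R\<close>.\<close>
  have R'_cases: "(x, y) \<in> R \<or> ((x, a) \<in> R \<or> (x, b) \<in> R) \<and> ((y, a) \<in> R \<or> (y, b) \<in> R)"
    if "(x, y) \<in> R'" for x y
    using that unfolding R'_def
  proof (induction rule: rtrancl_induct)
    case base
    then show ?case by (simp add: reflR)
  next
    case (step y z)
    then consider "(y, z) \<in> R" | "y = a" "z = b" | "y = b" "z = a"
      unfolding R_def p by auto
    then show ?case
    proof cases
      case 1
      then show ?thesis
        using step.IH symR[of y z] transR[of x y z] transR[of z y a] transR[of z y b] by blast
    qed (use step.IH reflR[of a] reflR[of b] in auto)
  qed
  have "R \<subseteq> R'" unfolding R_def R'_def by (rule rtrancl_mono) auto
  have R'R: "R' `` (R `` {x}) = R' `` {x}" for x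
  proof -
    have "(x, z) \<in> R'" if "(x, y) \<in> R" "(y, z) \<in> R'" for y z
      using that \<open>R \<subseteq> R'\<close> unfolding R'_def by (meson rtrancl_trans subsetD)
    then show ?thesis using reflR by blast
  qed
  \<comment> \<open>Only the classes of \<open>a\<close> and \<open>b\<close> can merge; once that
    of \<open>b\<close> is set aside, the remaining ones stay distinct.\<close>
  have "inj_on (\<lambda>c. R' `` c) (X // R - {R `` {b}})"
  proof (rule inj_onI)
    fix c d assume "c \<in> X // R - {R `` {b}}" "d \<in> X // R - {R `` {b}}" and eq: "R' `` c = R' `` d"
    then obtain x y where c: "c = R `` {x}" "R `` {x} \<noteq> R `` {b}"
      and d: "d = R `` {y}" "R `` {y} \<noteq> R `` {b}" by (auto simp: quotient_def)
    then have "(x, b) \<notin> R" "(y, b) \<notin> R" using eqR by (simp_all add: equiv_class_eq_iff)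
    moreover have "R' `` {x} = R' `` {y}" using eq c(1) d(1) by (simp add: R'R)
    then have "(x, y) \<in> R'" by (auto simp: R'_def)
    ultimately have "(x, y) \<in> R" using R'_cases[of x y] symR[of y a] transR[of x a y] symR[of y b] transR[of x b y] by blast
    then show "c = d" using c d eqR by (simp add: equiv_class_eq_iff)
  qed
  moreover have "(\<lambda>c. R' `` c) ` (X // R - {R `` {b}}) \<subseteq> X // R'"
    by (auto simp: quotient_def R'R)
  moreover have fin: "finite (X // R')" "finite (X // R)"
    using assms(2) by (simp_all add: quotient_def)
  ultimately have "card (X // R - {R `` {b}}) \<le> card (X // R')"
    by (metis card_inj_on_le)
  moreover have "card (X // R) \<le> Suc (card (X // R - {R `` {b}}))"
    by (simp add: card_Diff_singleton_if) linarith
  ultimately have "card (X // R) \<le> Suc (card (X // R'))" by linarith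
  then show ?case
    using insert.IH insert.hyps by (simp add: R_def R'_def)
qed

text \<open>By \<open>closed\<close>, chains that start in \<open>X\<close> never leave it, so the
  classes of its points are already generated by the pairs inside \<open>X\<close>.\<close>

corollary card_le_card_quotient_add_card_Int:
  assumes "finite r" "finite X" and closed: "\<And>x y. (x, y) \<in> r \<Longrightarrow> x \<in> X \<longleftrightarrow> y \<in> X"
  shows "card X \<le> card (X // (r \<union> r\<inverse>)\<^sup>*) + card (r \<inter> X \<times> X)"
proof -
  define s where "s = r \<inter> X \<times> X"
  have "(s \<union> s\<inverse>)\<^sup>* `` {x} = (r \<union> r\<inverse>)\<^sup>* `` {x}" if "x \<in> X" for x
  proof
    show "(s \<union> s\<inverse>)\<^sup>* `` {x} \<subseteq> (r \<union> r\<inverse>)\<^sup>* `` {x}"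
      unfolding s_def by (intro Image_mono rtrancl_mono) auto
    have "y \<in> X \<and> (x, y) \<in> (s \<union> s\<inverse>)\<^sup>*" if "(x, y) \<in> (r \<union> r\<inverse>)\<^sup>*" for y
      using that
    proof (induction rule: rtrancl_induct)
      case base
      then show ?case using \<open>x \<in> X\<close> by simp
    next
      case (step y z)
      then have "z \<in> X" using closed by blast
      moreover have "(y, z) \<in> s \<union> s\<inverse>" using step \<open>z \<in> X\<close> by (auto simp: s_def)
      ultimately show ?case using step.IH by (meson rtrancl.rtrancl_into_rtrancl)
    qed
    then show "(r \<union> r\<inverse>)\<^sup>* `` {x} \<subseteq> (s \<union> s\<inverse>)\<^sup>* `` {x}" by auto
  qed
  then have "X // (r \<union> r\<inverse>)\<^sup>* = X // (s \<union> s\<inverse>)\<^sup>*"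
    by (simp add: quotient_def)
  then show ?thesis
    using card_le_card_quotient_add_card[of s X] assms(1,2) by (simp add: s_def)
qed

section \<open>Folding\<close>

lemma connected_image:
  assumes "wf_digraph G" "connected G" "graph_morphism G K fv fe" "fv ` verts G = verts K"
  shows "connected K"
proof -
  interpret G: wf_digraph G by fact
  have adj: "(fv u, fv v) \<in> parcs (mk_symmetric K)" if uv: "(u, v) \<in> parcs (mk_symmetric G)" for u v
  proof -
    obtain e where e: "e \<in> arcs G"
        and "u = tail G e \<and> v = head G e \<or> u = head G e \<and> v = tail G e"
      using uv by (auto simp: parcs_mk_symmetric)
    moreover from e have "fe e \<in> arcs K" "tail K (fe e) = fv (tail G e)" "head K (fe e) = fv (head G e)"
      using assms(3) by (auto simp: graph_morphism_def)
    ultimately show ?thesis unfolding parcs_mk_symmetric by force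
  qed
  have reach: "fv u \<rightarrow>\<^sup>*\<^bsub>mk_symmetric K\<^esub> fv v" if "u \<rightarrow>\<^sup>*\<^bsub>mk_symmetric G\<^esub> v" for u v
    using that
    unfolding reachable_def
  proof (induction rule: rtrancl_on_induct)
    case base
    then show ?case using assms(4) by (auto simp: reachable_def)
  next
    case (step x y)
    then have "fv x \<in> verts K" "fv y \<in> verts K" using assms(4) by auto
    moreover have "(fv x, fv y) \<in> parcs (mk_symmetric K)" using step(2) adj by simp
    ultimately show ?case
      using step.IH by (auto intro: rtrancl_on_into_rtrancl_on)
  qed
  show ?thesis
    unfolding connected_def strongly_connected_def
  proof (intro conjI ballI)
    show "verts (with_proj (mk_symmetric K)) \<noteq> {}"
      using assms(2,4) by (auto simp: connected_def strongly_connected_def)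
  next
    fix x y assume "x \<in> verts (with_proj (mk_symmetric K))" "y \<in> verts (with_proj (mk_symmetric K))"
    then have "x \<in> fv ` verts G" "y \<in> fv ` verts G" using assms(4) by auto
    then obtain u v where "u \<in> verts G" "v \<in> verts G" "x = fv u" "y = fv v"
      by blast
    then show "x \<rightarrow>\<^sup>*\<^bsub>mk_symmetric K\<^esub> y"
      using assms(2) reach by (simp add: connected_def strongly_connected_def)
  qed
qed

lemma compressed_imp_immersed: "compressed B H lv le \<Longrightarrow> immersed_graph B H lv le"
  unfolding compressed_def by (rule conjunct1)

text \<open>
  A quotient of \<open>H\<close> over \<open>B\<close> is encoded by its projections \<open>f\<close> on vertices and \<open>g\<close> on edges. A
  folding replaces these projections, so no intermediate graph has to be built.
\<close>

lemma compressed_rank_le_nat: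
  fixes f :: "'v \<Rightarrow> nat" and g :: "'e \<Rightarrow> nat"
  assumes compressed: "compressed B H lv le"
    and "\<And>u v. u \<in> verts H \<Longrightarrow> v \<in> verts H \<Longrightarrow> f u = f v \<Longrightarrow> lv u = lv v"
    and "\<And>d e. d \<in> arcs H \<Longrightarrow> e \<in> arcs H \<Longrightarrow> g d = g e \<Longrightarrow>
      le d = le e \<and> f (tail H d) = f (tail H e) \<and> f (head H d) = f (head H e)"
  shows "graph_rank H \<le> 1 - int (card (f ` verts H)) + int (card (g ` arcs H))"
  using assms(2,3)
\<comment> \<open>The induction is on the number of edges of the quotient, which every fold
  lowers.\<close>
proof (induction "card (g ` arcs H)" arbitrary: f g rule: less_induct)
  case less
  note f = less.prems(1) and g = less.prems(2)
  have imm: "graph_immersion H B lv le" and "fin_digraph H" and conn: "connected H"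
    using compressed by (auto simp: compressed_def immersed_graph_def)
  interpret H: fin_digraph H by fact
  have tail_le: "tail B (le e) = lv (tail H e)" and head_le: "head B (le e) = lv (head H e)"
    and le_arcs: "le e \<in> arcs B" if "e \<in> arcs H" for e
    using imm that by (auto simp: graph_immersion_def graph_morphism_def)
  have lv_verts: "lv v \<in> verts B" if "v \<in> verts H" for v
    using imm that by (auto simp: graph_immersion_def graph_morphism_def)
  have out_inj: "d = e" if "d \<in> arcs H" "e \<in> arcs H" "le d = le e" "tail H d = tail H e" for d e
  proof -
    have "inj_on (map_sum le le) (germs H (tail H e))"
      using imm that by (auto simp: graph_immersion_def)
    then have "Inl d = (Inl e :: 'e + 'e)"
      by (rule inj_onD) (use that in \<open>auto simp: germs_def\<close>)
    then show ?thesis by simp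
  qed
  have in_inj: "d = e" if "d \<in> arcs H" "e \<in> arcs H" "le d = le e" "head H d = head H e" for d e
  proof -
    have "inj_on (map_sum le le) (germs H (head H e))"
      using imm that by (auto simp: graph_immersion_def)
    then have "Inr d = (Inr e :: 'e + 'e)"
      by (rule inj_onD) (use that in \<open>auto simp: germs_def\<close>)
    then show ?thesis by simp
  qed
  show ?case
  \<comment> \<open>A fold is possible: two distinct edges of the quotient with the same label share
    their origin or their terminus.\<close>
  proof (cases "\<exists>d\<in>arcs H. \<exists>e\<in>arcs H. g d \<noteq> g e \<and> le d = le e \<and>
      (f (tail H d) = f (tail H e) \<or> f (head H d) = f (head H e))")
    case True
    then obtain d e where de: "d \<in> arcs H" "e \<in> arcs H" "g d \<noteq> g e" "le d = le e"
      and or: "f (tail H d) = f (tail H e) \<or> f (head H d) = f (head H e)" by blast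
    have "lv (tail H d) = lv (tail H e)" "lv (head H d) = lv (head H e)"
      using de tail_le[of d] tail_le[of e] head_le[of d] head_le[of e] by auto
    \<comment> \<open>\<open>x\<close> and \<open>y\<close> are the ends of \<open>d\<close> and
      \<open>e\<close> on the side opposite to a shared end; gluing their images makes both ends
      agree.\<close>
    with de or obtain x y where xy: "x \<in> verts H" "y \<in> verts H" "lv x = lv y"
      and fx: "\<And>h :: nat \<Rightarrow> nat. h (f x) = h (f y) \<Longrightarrow>
        h (f (tail H d)) = h (f (tail H e)) \<and> h (f (head H d)) = h (f (head H e))"
      by (elim disjE) (auto intro: that[of "head H d" "head H e"] that[of "tail H d" "tail H e"])
    define h where "h z = (if z = f y then f x else z)" for z
    define k where "k z = (if z = g e then g d else z)" for z
    have ends: "h (f (tail H d)) = h (f (tail H e)) \<and> h (f (head H d)) = h (f (head H e))"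
      by (rule fx) (simp add: h_def)
    have "(k \<circ> g) ` arcs H \<subseteq> g ` arcs H - {g e}"
      using de by (auto simp: k_def)
    moreover have "g e \<in> g ` arcs H" using de by simp
    ultimately have less: "card ((k \<circ> g) ` arcs H) < card (g ` arcs H)"
      by (intro psubset_card_mono) auto
    have "graph_rank H \<le> 1 - int (card ((h \<circ> f) ` verts H)) + int (card ((k \<circ> g) ` arcs H))"
    proof (rule less.hyps[OF less])
      fix u v assume "u \<in> verts H" "v \<in> verts H" "(h \<circ> f) u = (h \<circ> f) v"
      then consider "f u = f v" | "f u = f x" "f v = f y" | "f u = f y" "f v = f x"
        by (auto simp: h_def split: if_splits)
      then show "lv u = lv v"
        using f[of u v] f[of u x] f[of v y] f[of u y] f[of v x] xy \<open>u \<in> verts H\<close> \<open>v \<in> verts H\<close>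
        by cases auto
    next
      fix a b assume "a \<in> arcs H" "b \<in> arcs H" "(k \<circ> g) a = (k \<circ> g) b"
      then consider "g a = g b" | "g a = g e" "g b = g d" | "g a = g d" "g b = g e"
        by (auto simp: k_def split: if_splits)
      then show "le a = le b \<and> (h \<circ> f) (tail H a) = (h \<circ> f) (tail H b)
          \<and> (h \<circ> f) (head H a) = (h \<circ> f) (head H b)"
        using g[of a b] g[of a d] g[of a e] g[of b d] g[of b e]
          \<open>a \<in> arcs H\<close> \<open>b \<in> arcs H\<close> de ends by cases auto
    qed
    \<comment> \<open>A fold removes at least one edge and at most one vertex of the quotient, so
      the rank does not grow.\<close>
    moreover have "card (f ` verts H) \<le> card (insert (f y) ((h \<circ> f) ` verts H))"
      by (rule card_mono) (auto simp: h_def)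
    then have "card (f ` verts H) \<le> Suc (card ((h \<circ> f) ` verts H))"
      by (simp add: card_insert_if split: if_splits)
    ultimately show ?thesis using less by linarith
  next
    case False
    \<comment> \<open>No fold is left. The representatives \<open>r\<close> and \<open>s\<close>
      carry ends and labels over to the quotient \<open>K\<close>; the hypotheses on
      \<open>f\<close> and \<open>g\<close> make these independent of the choice.\<close>
    define r where "r = inv_into (arcs H) g"
    have r: "r (g e) \<in> arcs H" "g (r (g e)) = g e" if "e \<in> arcs H" for e
      using that by (auto simp: r_def inv_into_into f_inv_into_f)
    have r_eqs: "le (r (g e)) = le e" "f (tail H (r (g e))) = f (tail H e)"
        "f (head H (r (g e))) = f (head H e)" if "e \<in> arcs H" for e
      using g[OF r(1)[OF that] that r(2)[OF that]] by auto
    define s where "s = inv_into (verts H) f"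
    have s: "lv (s (f v)) = lv v" if "v \<in> verts H" for v
      using f[of "s (f v)" v] that by (simp add: s_def inv_into_into f_inv_into_f)
    define K where "K = \<lparr>verts = f ` verts H, arcs = g ` arcs H,
      tail = (\<lambda>a. f (tail H (r a))), head = (\<lambda>a. f (head H (r a)))\<rparr>"
    have K: "verts K = f ` verts H" "arcs K = g ` arcs H"
      "tail K a = f (tail H (r a))" "head K a = f (head H (r a))" for a
      by (simp_all add: K_def)
    have fold: "g d = g e" if "d \<in> arcs H" "e \<in> arcs H" "le d = le e"
        "f (tail H d) = f (tail H e) \<or> f (head H d) = f (head H e)" for d e
      using False that by blast
    have g_le: "le d = le e" if "d \<in> arcs H" "e \<in> arcs H" "g d = g e" for d e
      using g[OF that] by blast
    have mor: "graph_morphism H K f g"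
      by (auto simp: graph_morphism_def K r_eqs)
    \<comment> \<open>Edges with equal image in \<open>K\<close> have equal labels, and labels
      already separate the germs at a vertex of \<open>H\<close>.\<close>
    have "graph_immersion H K f g"
      unfolding graph_immersion_def
    proof (intro conjI ballI mor inj_onI)
      fix v x y assume "x \<in> germs H v" "y \<in> germs H v" "map_sum g g x = map_sum g g y"
      then show "x = y"
        by (auto simp: germs_def intro: out_inj[OF _ _ g_le] in_inj[OF _ _ g_le])
    qed
    \<comment> \<open>Local injectivity over \<open>B\<close> is the absence of folds.\<close>
    moreover have "graph_immersion K B (lv \<circ> s) (le \<circ> r)"
      unfolding graph_immersion_def graph_morphism_def
    proof (intro conjI ballI inj_onI)
      fix v x y assume "x \<in> germs K v" "y \<in> germs K v"
        "map_sum (le \<circ> r) (le \<circ> r) x = map_sum (le \<circ> r) (le \<circ> r) y"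
      then show "x = y"
        by (auto simp: germs_def K r_eqs intro!: fold)
    qed (auto simp: K s r_eqs lv_verts le_arcs tail_le head_le)
    moreover have "fin_digraph K"
      by unfold_locales (auto simp: K r_eqs)
    moreover have "connected K"
      using connected_image[OF _ conn mor] by (simp add: K H.wf_digraph_axioms)
    moreover have "label_preserving H lv le (lv \<circ> s) (le \<circ> r) f g"
      by (auto simp: label_preserving_def s r_eqs)
    ultimately have "graph_rank H \<le> graph_rank K"
      using compressed unfolding compressed_def immersed_graph_def by blast
    then show ?thesis by (simp add: graph_rank_def K)
  qed
qed

text \<open>The images of \<open>f\<close> and \<open>g\<close> are finite and so embed into
  \<open>nat\<close>. This admits the option and sum types that describe the collapse.\<close>

lemma compressed_rank_le:
  fixes f :: "'v \<Rightarrow> 'x" and g :: "'e \<Rightarrow> 'y"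
  assumes compressed: "compressed B H lv le"
    and f: "\<And>u v. u \<in> verts H \<Longrightarrow> v \<in> verts H \<Longrightarrow> f u = f v \<Longrightarrow> lv u = lv v"
    and g: "\<And>d e. d \<in> arcs H \<Longrightarrow> e \<in> arcs H \<Longrightarrow> g d = g e \<Longrightarrow>
      le d = le e \<and> f (tail H d) = f (tail H e) \<and> f (head H d) = f (head H e)"
  shows "graph_rank H \<le> 1 - int (card (f ` verts H)) + int (card (g ` arcs H))"
proof -
  interpret H: fin_digraph H
    using compressed_imp_immersed[OF compressed] by (simp add: immersed_graph_def)
  obtain i :: "'x \<Rightarrow> nat" where i: "inj_on i (f ` verts H)"
    using finite_imp_inj_to_nat_seg[of "f ` verts H"] by auto
  obtain j :: "'y \<Rightarrow> nat" where j: "inj_on j (g ` arcs H)"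
    using finite_imp_inj_to_nat_seg[of "g ` arcs H"] by auto
  have "graph_rank H \<le> 1 - int (card ((i \<circ> f) ` verts H)) + int (card ((j \<circ> g) ` arcs H))"
  proof (rule compressed_rank_le_nat[OF compressed])
    fix u v assume uv: "u \<in> verts H" "v \<in> verts H" "(i \<circ> f) u = (i \<circ> f) v"
    then have "f u = f v" using inj_onD[OF i, of "f u" "f v"] by simp
    then show "lv u = lv v" by (rule f[OF uv(1,2)])
  next
    fix d e assume de: "d \<in> arcs H" "e \<in> arcs H" "(j \<circ> g) d = (j \<circ> g) e"
    then have "g d = g e" using inj_onD[OF j, of "g d" "g e"] by simp
    then show "le d = le e \<and> (i \<circ> f) (tail H d) = (i \<circ> f) (tail H e)
        \<and> (i \<circ> f) (head H d) = (i \<circ> f) (head H e)"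
      using g[OF de(1,2)] by simp
  qed
  then show ?thesis
    using card_image[OF i] card_image[OF j] by (simp add: image_comp)
qed

section \<open>Arcs of core graphs\<close>

lemma (in fin_digraph) sum_vert_degree: "(\<Sum>v\<in>verts G. vert_degree G v) = 2 * card (arcs G)"
proof -
  have "(\<Sum>v\<in>verts G. card (out_arcs G v)) = card (\<Union>v\<in>verts G. out_arcs G v)"
    by (rule card_UN_disjoint[symmetric]) auto
  moreover have "(\<Union>v\<in>verts G. out_arcs G v) = arcs G" by auto
  moreover have "(\<Sum>v\<in>verts G. card (in_arcs G v)) = card (\<Union>v\<in>verts G. in_arcs G v)"
    by (rule card_UN_disjoint[symmetric]) auto
  moreover have "(\<Union>v\<in>verts G. in_arcs G v) = arcs G" by auto
  ultimately show ?thesis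
    by (simp add: vert_degree_def in_degree_def out_degree_def sum.distrib)
qed

text \<open>Otherwise the degree sum, twice the number of edges, is at most twice the number of
  vertices, which forces rank at most 1.\<close>

lemma branch_verts_nonempty:
  assumes "fin_digraph G" "graph_rank G > 1"
  shows "branch_verts G \<noteq> {}"
proof
  interpret fin_digraph G by fact
  assume "branch_verts G = {}"
  then have "(\<Sum>v\<in>verts G. vert_degree G v) \<le> (\<Sum>v\<in>verts G. 2)"
    by (intro sum_mono) (force simp: branch_verts_def)
  then show False
    using assms(2) by (simp add: sum_vert_degree graph_rank_def)
qed

lemma finite_punctured_cells: "fin_digraph G \<Longrightarrow> finite (punctured_cells G)"
  using fin_digraph.finite_verts fin_digraph.finite_arcs by (auto simp: punctured_cells_def)

lemma equiv_incidence_closure: "equiv UNIV ((cell_incidence G \<union> (cell_incidence G)\<inverse>)\<^sup>*)"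
  by (intro equivI refl_rtrancl sym_rtrancl trans_rtrancl) (auto intro: symI)

lemma cell_incidence_subset: "cell_incidence G \<subseteq> punctured_cells G \<times> punctured_cells G"
  by (auto simp: cell_incidence_def punctured_cells_def)

lemma topological_arc_subset:
  assumes "T \<in> topological_arcs G"
  shows "T \<subseteq> punctured_cells G"
proof
  fix y assume "y \<in> T"
  then obtain x where "x \<in> punctured_cells G"
    and "(x, y) \<in> (cell_incidence G \<union> (cell_incidence G)\<inverse>)\<^sup>*"
    using assms by (auto simp: topological_arcs_def quotient_def)
  from this(2,1) show "y \<in> punctured_cells G"
    by (induction rule: rtrancl_induct) (use cell_incidence_subset in blast)+
qed

lemma topological_arc_closed:
  assumes "T \<in> topological_arcs G" "(x, y) \<in> cell_incidence G"
  shows "x \<in> T \<longleftrightarrow> y \<in> T"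
proof -
  have "(x, y) \<in> (cell_incidence G \<union> (cell_incidence G)\<inverse>)\<^sup>*"
    using assms(2) by auto
  moreover have "T \<in> UNIV // (cell_incidence G \<union> (cell_incidence G)\<inverse>)\<^sup>*"
    using assms(1) by (auto simp: topological_arcs_def quotient_def)
  ultimately show ?thesis
    using in_quotient_imp_closed[OF equiv_incidence_closure]
      equiv_incidence_closure[of G, THEN equivE] by (meson symD)
qed

lemma Union_topological_arcs: "\<Union> (topological_arcs G) = punctured_cells G"
proof
  show "\<Union> (topological_arcs G) \<subseteq> punctured_cells G"
    using topological_arc_subset by blast
  show "punctured_cells G \<subseteq> \<Union> (topological_arcs G)"
    by (auto simp: topological_arcs_def quotient_def)
qed

text \<open>A vertex of a core graph has an incident edge, and for a non-branch vertex this edge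
  lies in the same component. Hence an edge can be chosen even in an arc left out by the
  matching.\<close>

lemma topological_arc_has_edge:
  assumes "core_graph G" "T \<in> topological_arcs G"
  shows "\<exists>e\<in>arcs G. Inr e \<in> T"
proof -
  obtain x where x: "x \<in> T" "x \<in> punctured_cells G"
    using assms(2) by (auto simp: topological_arcs_def quotient_def)
  show ?thesis
  proof (cases x)
    case (Inr e)
    then show ?thesis using x by (auto simp: punctured_cells_def)
  next
    case (Inl v)
    then have v: "v \<in> verts G - branch_verts G" using x by (auto simp: punctured_cells_def)
    then have "vert_degree G v \<ge> 2" using assms(1) by (simp add: core_graph_def)
    then have "in_arcs G v \<union> out_arcs G v \<noteq> {}"
      by (auto simp: vert_degree_def in_degree_def out_degree_def)
    then obtain e where "e \<in> arcs G" "v = tail G e \<or> v = head G e"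
      unfolding in_arcs_def out_arcs_def by blast
    then have "(Inl v, Inr e) \<in> cell_incidence G" using v by (auto simp: cell_incidence_def)
    then show ?thesis
      using topological_arc_closed[OF assms(2)] x Inl \<open>e \<in> arcs G\<close> by blast
  qed
qed

text \<open>The component count is applied to the cells in \<open>Y\<close>: they form at most
  \<open>card Y\<close> classes, and each vertex among them has at most two incidences. Cancelling
  the number of vertices once gives the bound.\<close>

lemma card_edges_le_card_verts_add_card_arcs:
  assumes "fin_digraph G" and Y: "Y \<subseteq> topological_arcs G"
  shows "card {e. Inr e \<in> \<Union> Y} \<le> card {v. Inl v \<in> \<Union> Y} + card Y"
proof -
  interpret fin_digraph G by fact
  define X where "X = \<Union> Y"
  define V where "V = {v. Inl v \<in> X}"
  define E where "E = {e. Inr e \<in> X}"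
  let ?r = "cell_incidence G"
  have X: "X \<subseteq> punctured_cells G" using Y topological_arc_subset by (auto simp: X_def)
  have V: "V \<subseteq> verts G - branch_verts G" and E: "E \<subseteq> arcs G"
    using X by (auto simp: V_def E_def punctured_cells_def)
  then have fin: "finite V" "finite E" "finite X"
    using finite_punctured_cells[OF assms(1)] X
    by (auto intro: finite_subset[of _ "verts G"] finite_subset)
  have "X = V <+> E"
  proof (rule set_eqI)
    fix x show "x \<in> X \<longleftrightarrow> x \<in> V <+> E" by (cases x) (auto simp: V_def E_def)
  qed
  then have "card V + card E = card X" using fin by (simp add: card_Plus)
  also have "\<dots> \<le> card (X // (?r \<union> ?r\<inverse>)\<^sup>*) + card (?r \<inter> X \<times> X)"
  proof (rule card_le_card_quotient_add_card_Int)
    show "finite ?r"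
      by (rule finite_subset[OF cell_incidence_subset])
        (simp add: finite_punctured_cells[OF assms(1)])
    show "x \<in> X \<longleftrightarrow> y \<in> X" if "(x, y) \<in> ?r" for x y
      using topological_arc_closed[OF _ that] Y by (auto simp: X_def)
  qed (rule fin)
  also have "card (X // (?r \<union> ?r\<inverse>)\<^sup>*) \<le> card Y"
  proof (rule card_mono)
    have "finite (topological_arcs G)"
      using finite_punctured_cells[OF assms(1)] by (simp add: topological_arcs_def quotient_def)
    then show "finite Y" using Y finite_subset by blast
    show "X // (?r \<union> ?r\<inverse>)\<^sup>* \<subseteq> Y"
    proof
      fix c assume "c \<in> X // (?r \<union> ?r\<inverse>)\<^sup>*"
      then obtain x T where c: "c = (?r \<union> ?r\<inverse>)\<^sup>* `` {x}" and x: "x \<in> T" "T \<in> Y"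
        by (auto simp: quotient_def X_def)
      then obtain z where "T = (?r \<union> ?r\<inverse>)\<^sup>* `` {z}"
        using Y by (auto simp: topological_arcs_def quotient_def)
      moreover from this x have "(?r \<union> ?r\<inverse>)\<^sup>* `` {z} = (?r \<union> ?r\<inverse>)\<^sup>* `` {x}"
        using equiv_incidence_closure[of G] by (intro equiv_class_eq) auto
      ultimately show "c \<in> Y" using c x by simp
    qed
  qed
  also have "card (?r \<inter> X \<times> X) \<le> 2 * card V" \<comment> \<open>vertices in \<open>V\<close> have degree at most 2\<close>
  proof -
    have "?r \<inter> X \<times> X \<subseteq> (\<Union>v\<in>V. (\<lambda>e. (Inl v, Inr e)) ` (in_arcs G v \<union> out_arcs G v))"
      by (auto simp: cell_incidence_def V_def)
    then have "card (?r \<inter> X \<times> X)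
        \<le> card (\<Union>v\<in>V. (\<lambda>e. (Inl v :: 'a + 'b, Inr e :: 'a + 'b)) ` (in_arcs G v \<union> out_arcs G v))"
      using fin by (intro card_mono) auto
    also have "\<dots> \<le> (\<Sum>v\<in>V. card ((\<lambda>e. (Inl v :: 'a + 'b, Inr e :: 'a + 'b)) ` (in_arcs G v \<union> out_arcs G v)))"
      by (rule card_UN_le[OF fin(1)])
    also have "\<dots> \<le> (\<Sum>v\<in>V. 2)"
    proof (rule sum_mono)
      fix v assume "v \<in> V"
      have "card ((\<lambda>e. (Inl v :: 'a + 'b, Inr e :: 'a + 'b)) ` (in_arcs G v \<union> out_arcs G v))
          \<le> card (in_arcs G v \<union> out_arcs G v)"
        by (rule card_image_le) auto
      also have "\<dots> \<le> vert_degree G v"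
        unfolding vert_degree_def in_degree_def out_degree_def by (rule card_Un_le)
      also have "\<dots> \<le> 2" using \<open>v \<in> V\<close> V by (force simp: branch_verts_def)
      finally show "card ((\<lambda>e. (Inl v :: 'a + 'b, Inr e :: 'a + 'b)) ` (in_arcs G v \<union> out_arcs G v)) \<le> 2" .
    qed
    finally show ?thesis by simp
  qed
  finally have "card E \<le> card V + card Y" by linarith
  then show ?thesis by (simp add: E_def V_def X_def)
qed

text \<open>With \<open>V\<close> and \<open>E\<close> the vertices and edges in \<open>Y\<close>,
  the collapsed graph has at least \<open>card V + 1\<close> vertices and at most
  \<open>card E + card S\<close> edges, where \<open>card E \<le> card V + card Y\<close>.\<close>

lemma rank_le_card_cover:
  assumes "bouquet n B" "compressed B H lv le" "graph_rank H > 1"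
    and Y: "Y \<subseteq> topological_arcs H" and "finite S"
    and S: "\<And>e. e \<in> arcs H \<Longrightarrow> Inr e \<notin> \<Union> Y \<Longrightarrow> le e \<in> S"
  shows "graph_rank H \<le> int (card Y + card S)"
proof -
  interpret H: fin_digraph H
    using compressed_imp_immersed[OF assms(2)] by (simp add: immersed_graph_def)
  \<comment> \<open>\<open>None\<close> is the collapsed vertex; it absorbs all branch vertices,
    since these lie in no arc.\<close>
  define f where "f v = (if Inl v \<in> \<Union> Y then Some v else None)" for v
  \<comment> \<open>Edges in \<open>Y\<close> stay distinct; the others are identified exactly when
    their labels agree.\<close>
  define g where "g e = (if Inr e \<in> \<Union> Y then Inl e else Inr (le e))" for e
  define V where "V = {v. Inl v \<in> \<Union> Y}"
  define E where "E = {e. Inr e \<in> \<Union> Y}"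
  have "\<Union> Y \<subseteq> punctured_cells H" using Y topological_arc_subset by blast
  then have V: "V \<subseteq> verts H - branch_verts H" and E: "E \<subseteq> arcs H"
    by (auto simp: V_def E_def punctured_cells_def)
  then have fin: "finite V" "finite E"
    by (auto intro: finite_subset[of _ "verts H"] finite_subset)
  \<comment> \<open>\<open>B\<close> has a single vertex, so any identification of vertices respects
    \<open>lv\<close>.\<close>
  have lv: "lv u = lv v" if "u \<in> verts H" "v \<in> verts H" for u v
  proof -
    obtain b where "verts B = {b}"
      using assms(1) by (auto simp: bouquet_def card_1_singleton_iff)
    then show ?thesis
      using compressed_imp_immersed[OF assms(2)] that
      by (simp add: immersed_graph_def graph_immersion_def graph_morphism_def)
  qed
  \<comment> \<open>An end not sent to \<open>None\<close> would be a non-branch vertex in an arc of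
    \<open>Y\<close>, and that arc would contain \<open>e\<close> as well.\<close>
  have ends: "f (tail H e) = None \<and> f (head H e) = None" if e: "e \<in> arcs H" "Inr e \<notin> \<Union> Y" for e
  proof -
    have "Inl v \<notin> \<Union> Y" if v: "v = tail H e \<or> v = head H e" for v
    proof
      assume "Inl v \<in> \<Union> Y"
      then obtain T where T: "T \<in> Y" "Inl v \<in> T" by blast
      have "v \<in> V" using \<open>Inl v \<in> \<Union> Y\<close> by (simp add: V_def)
      then have "v \<in> verts H - branch_verts H" using V by blast
      then have "(Inl v, Inr e) \<in> cell_incidence H"
        using v e(1) unfolding cell_incidence_def by blast
      then have "Inr e \<in> T"
        using topological_arc_closed[of T H "Inl v" "Inr e"] T Y by auto
      then show False using T(1) e(2) by blast
    qed
    then show ?thesis by (simp add: f_def)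
  qed
  have "graph_rank H \<le> 1 - int (card (f ` verts H)) + int (card (g ` arcs H))"
  proof (rule compressed_rank_le[OF assms(2)])
    fix d e assume "d \<in> arcs H" "e \<in> arcs H" "g d = g e"
    then show "le d = le e \<and> f (tail H d) = f (tail H e) \<and> f (head H d) = f (head H e)"
      using ends[of d] ends[of e] by (auto simp: g_def split: if_splits)
  qed (rule lv)
  moreover have "Suc (card V) \<le> card (f ` verts H)"
  proof -
    \<comment> \<open>Rank above 1 supplies a branch vertex, which ensures that \<open>None\<close>
      is attained and adds one to \<open>card V\<close>.\<close>
    obtain b where "b \<in> branch_verts H"
      using branch_verts_nonempty[OF H.fin_digraph_axioms assms(3)] by blast
    then have "b \<in> verts H" "b \<notin> V" using V by (auto simp: branch_verts_def)
    then have "None \<in> f ` verts H"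
      by (intro image_eqI[of _ _ b]) (simp_all add: f_def V_def)
    moreover have "Some v \<in> f ` verts H" if "v \<in> V" for v
      using that V by (intro image_eqI[of _ _ v]) (auto simp: f_def V_def)
    ultimately have "insert None (Some ` V) \<subseteq> f ` verts H" by blast
    then have "card (insert None (Some ` V)) \<le> card (f ` verts H)"
      by (intro card_mono) auto
    then show ?thesis using fin by (simp add: card_image)
  qed
  moreover have "card (g ` arcs H) \<le> card E + card S"
  proof -
    have "g e \<in> E <+> S" if "e \<in> arcs H" for e
      using S[OF that] by (simp add: g_def E_def InlI InrI)
    then have "g ` arcs H \<subseteq> E <+> S" by blast
    then have "card (g ` arcs H) \<le> card (E <+> S)"
      using fin \<open>finite S\<close> by (intro card_mono) auto
    then show ?thesis using fin \<open>finite S\<close> by (simp add: card_Plus)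
  qed
  moreover have "card E \<le> card V + card Y"
    unfolding E_def V_def by (rule card_edges_le_card_verts_add_card_arcs[OF H.fin_digraph_axioms Y])
  ultimately show ?thesis by linarith
qed

theorem proposition3p17:
  fixes B :: "('b, 'l) pre_digraph" and H :: "('v, 'e) pre_digraph"
    and lv :: "'v \<Rightarrow> 'b" and le :: "'e \<Rightarrow> 'l"
    and n m k :: nat and A :: "nat \<Rightarrow> ('v + 'e) set"
  assumes "bouquet n B"
    and "immersed_graph B H lv le"
    and "graph_surjective H B lv le"
    and "connected H"
    and "core_graph H"
    and "compressed B H lv le"
    and "graph_rank H = int m"
    and "m > 1"
    and "bij_betw A {1..k} (topological_arcs H)"
  shows "\<exists>t. (\<forall>i\<in>{1..k}. t i \<in> arcs H \<and> Inr (t i) \<in> A i) \<and> card (le ` (t ` {1..k})) \<ge> m"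
proof -
  interpret H: fin_digraph H using assms(2) by (simp add: immersed_graph_def)
  have A: "A i \<in> topological_arcs H" if "i \<in> {1..k}" for i
    using assms(9) that by (auto simp: bij_betw_def)
  \<comment> \<open>Arcs enter through their indices; a matching in \<open>R\<close> gives distinct
    arcs distinct labels, each occurring on its arc.\<close>
  define R where "R = {(i, le e) |i e. i \<in> {1..k} \<and> e \<in> arcs H \<and> Inr e \<in> A i}"
  have "R \<subseteq> {1..k} \<times> le ` arcs H" by (auto simp: R_def)
  then have "finite R" by (rule finite_subset) auto
  have "m \<le> card C + card S"
    if "finite C" "finite S" and cover: "\<forall>(i, l)\<in>R. i \<in> C \<or> l \<in> S" for C S
  proof -
    \<comment> \<open>A cover may contain indices outside \<open>{1..k}\<close>, where nothing is
      known about \<open>A\<close>; they are discarded.\<close>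
    let ?Y = "A ` (C \<inter> {1..k})"
    have "graph_rank H \<le> int (card ?Y + card S)"
    proof (rule rank_le_card_cover[OF assms(1,6)])
      show "graph_rank H > 1" using assms(7,8) by simp
      show "?Y \<subseteq> topological_arcs H" using A by blast
      show "finite S" by (rule that(2))
    next
      fix e assume e: "e \<in> arcs H" "Inr e \<notin> \<Union> ?Y"
      then have "Inr e \<in> \<Union> (topological_arcs H)"
        by (auto simp: Union_topological_arcs punctured_cells_def)
      then obtain i where "i \<in> {1..k}" "Inr e \<in> A i"
        using bij_betw_imp_surj_on[OF assms(9)] by blast
      then have "(i, le e) \<in> R" "i \<notin> C" using e by (auto simp: R_def)
      then show "le e \<in> S" using cover by blast
    qed
    moreover have "card ?Y \<le> card C"
      using card_image_le[of "C \<inter> {1..k}" A] card_mono[OF that(1), of "C \<inter> {1..k}"] by simp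
    ultimately show ?thesis using assms(7) by linarith
  qed
  then obtain M where M: "M \<subseteq> R" "inj_on fst M" "inj_on snd M" "m \<le> card M"
    using Koenig_matching[OF \<open>finite R\<close>] by blast
  \<comment> \<open>A matched arc takes an edge bearing its matched label, any other arc an
    arbitrary edge.\<close>
  have "\<exists>e. e \<in> arcs H \<and> Inr e \<in> A i \<and> (\<forall>l. (i, l) \<in> M \<longrightarrow> le e = l)" if i: "i \<in> {1..k}" for i
  proof (cases "i \<in> Domain M")
    case True
    then obtain l where l: "(i, l) \<in> M" by blast
    then obtain e where "e \<in> arcs H" "Inr e \<in> A i" "le e = l" using M(1) by (auto simp: R_def)
    moreover have "l' = l" if "(i, l') \<in> M" for l'
      using inj_onD[OF M(2) _ that l] by simp
    ultimately show ?thesis by blast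
  next
    case False
    then show ?thesis using topological_arc_has_edge[OF assms(5) A[OF i]] by blast
  qed
  then obtain t where t: "\<And>i. i \<in> {1..k} \<Longrightarrow>
      t i \<in> arcs H \<and> Inr (t i) \<in> A i \<and> (\<forall>l. (i, l) \<in> M \<longrightarrow> le (t i) = l)"
    by metis
  have "snd ` M \<subseteq> le ` (t ` {1..k})"
  proof
    fix l assume "l \<in> snd ` M"
    then obtain i where "(i, l) \<in> M" by auto
    moreover from this have "i \<in> {1..k}" using M(1) by (auto simp: R_def)
    ultimately show "l \<in> le ` (t ` {1..k})" using t by blast
  qed
  then have "card (snd ` M) \<le> card (le ` (t ` {1..k}))"
    by (intro card_mono) auto
  then have "m \<le> card (le ` (t ` {1..k}))"
    using M card_image[OF M(3)] by simp
  then show ?thesis using t by blast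
qed

end
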